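(* Let $K_5\setminus e$ denote the complete graph on five vertices with one edge removed. A random $h$-lift of $K_5\setminus e$ is asymptotically almost surely 3-colourable; that is, the probability that a random $h$-lift of $K_5\setminus e$ has a proper vertex colouring with 3 colours tends to $1$ as $h\to\infty$.
   Context: Let $G$ be a finite simple graph and $h$ a positive integer, $[h]=\{1,\dots,h\}$. Fix an orientation of the edges of $G$. Given permutations $\sigma_e$ of $[h]$, one for each $e\in E(G)$, the corresponding $h$-lift of $G$ is the graph with vertex set $V(G)\times[h]$ whose edges are $(u,j)(v,\sigma_{uv}(j))$ for every edge $uv$ of $G$ oriented $u\to v$ and every $j\in[h]$. A random $h$-lift of $G$ is obtained by choosing the permutations $\sigma_e$, $e\in E(G)$, independently and uniformly at random from all permutations of $[h]$ (the distribution does not depend on the orientation). "Asymptotically almost surely" (a.a.s.) means with probability tending to $1$ as $h\to\infty$. *)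

theory Defs
  imports "HOL-Probability.Probability" "HOL-Combinatorics.Permutations"
    "Graph_Theory.Kuratowski"
begin

text \<open>
  A finite simple graph is a \<^locale>\<open>pair_graph\<close>: every edge \<open>uv\<close> is represented by both of
  its arcs \<open>(u, v)\<close> and \<open>(v, u)\<close>.
\<close>

definition delete_edge :: "'a pair_pre_digraph \<Rightarrow> 'a \<Rightarrow> 'a \<Rightarrow> 'a pair_pre_digraph" where
  "delete_edge G u v = G\<lparr>parcs := parcs G - {(u, v), (v, u)}\<rparr>"

definition orientation :: "'a pair_pre_digraph \<Rightarrow> ('a \<times> 'a) set \<Rightarrow> bool" where
  "orientation G D \<longleftrightarrow> D \<union> D\<inverse> = parcs G \<and> D \<inter> D\<inverse> = {}"

definition lift_arcs :: "('a \<times> 'a) set \<Rightarrow> nat \<Rightarrow> ('a \<times> 'a \<Rightarrow> nat \<Rightarrow> nat)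
    \<Rightarrow> (('a \<times> nat) \<times> ('a \<times> nat)) set" where
  "lift_arcs D h \<sigma> = {((u, j), (v, \<sigma> (u, v) j)) | u v j. (u, v) \<in> D \<and> j \<in> {1..h}}"

definition lift_graph :: "'a pair_pre_digraph \<Rightarrow> ('a \<times> 'a) set \<Rightarrow> nat
    \<Rightarrow> ('a \<times> 'a \<Rightarrow> nat \<Rightarrow> nat) \<Rightarrow> ('a \<times> nat) pair_pre_digraph" where
  "lift_graph G D h \<sigma> =
     \<lparr>pverts = pverts G \<times> {1..h}, parcs = lift_arcs D h \<sigma> \<union> (lift_arcs D h \<sigma>)\<inverse>\<rparr>"

text \<open>
  The edges of the base graph are indexed by their chosen arcs in \<open>D\<close>; outside \<open>D\<close> the random
  family takes the irrelevant value \<^const>\<open>id\<close>.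
\<close>

definition random_lift :: "'a pair_pre_digraph \<Rightarrow> ('a \<times> 'a) set \<Rightarrow> nat
    \<Rightarrow> ('a \<times> nat) pair_pre_digraph pmf" where
  "random_lift G D h =
     map_pmf (lift_graph G D h) (Pi_pmf D id (\<lambda>_. pmf_of_set {\<pi>. \<pi> permutes {1..h}}))"

definition proper_colouring :: "nat \<Rightarrow> 'a pair_pre_digraph \<Rightarrow> ('a \<Rightarrow> nat) \<Rightarrow> bool" where
  "proper_colouring k G c \<longleftrightarrow>
     (\<forall>x \<in> pverts G. c x < k) \<and> (\<forall>(x, y) \<in> parcs G. c x \<noteq> c y)"

definition colourable :: "nat \<Rightarrow> 'a pair_pre_digraph \<Rightarrow> bool" where
  "colourable k G \<longleftrightarrow> (\<exists>c. proper_colouring k G c)"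

lemma pair_graph_delete_edge:
  assumes "pair_graph G"
  shows "pair_graph (delete_edge G u v)"
proof -
  interpret pair_graph G by fact
  show ?thesis
    by unfold_locales
      (auto simp: delete_edge_def symmetric_def sym_def arcs_ends_conv
        dest: wellformed no_loops' intro: arcs_symmetric)
qed

lemma pair_graph_lift_graph:
  assumes "pair_graph G" and D: "orientation G D"
    and perm: "\<And>e. e \<in> D \<Longrightarrow> \<sigma> e permutes {1..h}"
  shows "pair_graph (lift_graph G D h \<sigma>)"
proof -
  interpret pair_graph G by fact
  let ?A = "lift_arcs D h \<sigma>" and ?V = "pverts G \<times> {1..h}"
  have sub: "D \<subseteq> parcs G" using D by (auto simp: orientation_def)
  have A: "x \<in> ?V \<and> y \<in> ?V \<and> x \<noteq> y" if xy: "(x, y) \<in> ?A" for x y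
  proof -
    from xy obtain u v j where *: "x = (u, j)" "y = (v, \<sigma> (u, v) j)" "(u, v) \<in> D" "j \<in> {1..h}"
      by (auto simp: lift_arcs_def)
    moreover have "(u, v) \<in> parcs G" using * sub by auto
    moreover have "\<sigma> (u, v) j \<in> {1..h}" using * perm permutes_in_image by metis
    ultimately show ?thesis by (auto dest: in_arcsD1 in_arcsD2 no_loops')
  qed
  define L where "L = lift_graph G D h \<sigma>"
  have V: "pverts L = ?V" and E: "parcs L = ?A \<union> ?A\<inverse>"
    by (simp_all add: L_def lift_graph_def)
  have B: "fst e \<in> pverts L \<and> snd e \<in> pverts L \<and> fst e \<noteq> snd e" if "e \<in> parcs L" for e
  proof -
    obtain x y where e: "e = (x, y)" by (rule prod.exhaust)
    then have "(x, y) \<in> ?A \<or> (y, x) \<in> ?A" using that unfolding E by simp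
    then show ?thesis using A unfolding V e fst_conv snd_conv by blast
  qed
  have "parcs L \<subseteq> pverts L \<times> pverts L" using B by (auto simp: mem_Times_iff)
  moreover have fV: "finite (pverts L)" by (simp add: V)
  ultimately have "finite (parcs L)" using finite_subset by blast
  moreover have "sym (parcs L)" unfolding E by (auto simp: sym_def)
  ultimately have "pair_graph L"
    using B fV by unfold_locales (simp_all add: symmetric_def)
  then show ?thesis by (simp add: L_def)
qed

end

theory Submission
  imports Defs "HOL-Combinatorics.Orbits" "HOL-Analysis.Harmonic_Numbers" "HOL-Real_Asymp.Real_Asymp"
begin

text \<open>
  Let \<open>x\<close>, \<open>y\<close> be the two non-adjacent vertices and \<open>a\<close>, \<open>b\<close>, \<open>c\<close> the others. The lift of the triangle
  \<open>abc\<close> is a disjoint union of cycles, about \<open>ln h\<close> of them. Colour every cycle alternately with two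
  colours, except that each odd cycle gets one vertex of the third colour, in the fibre of \<open>a\<close>. A
  vertex above \<open>x\<close> or \<open>y\<close> can be coloured unless its three neighbours form a rainbow triple, and
  only the few triples meeting the third colour can be rainbow.

  Such a triple is repaired by moving to its vertex in the fibre of \<open>b\<close> and giving that vertex the
  third colour too. This endangers the other triple through it, which is repaired through its vertex
  in the fibre of \<open>a\<close>, and so on. The walk stops at a triple whose vertex in the fibre of \<open>c\<close> has the
  same colour as the vertex that would be recoloured next. Every second triple is inspected, and each
  inspection succeeds with probability about one half; walks that close up are harmless. So with
  high probability all walks have at most \<open>h powr (1/8)\<close> steps, and then so few vertices
  are recoloured that with high probability no two of them are adjacent.
\<close>

section \<open>The deterministic colouring\<close>

lemma ex_colour_avoiding:
  assumes "x < (3::nat)" "y < 3" "z < 3" "x = y \<or> x = z \<or> y = z"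
  shows "\<exists>t<3. t \<noteq> x \<and> t \<noteq> y \<and> t \<noteq> z"
  using assms by presburger

text \<open>The points visited by walks from \<open>V\<close> along \<open>f\<close>; a point of
  \<open>F\<close> is still visited but not left. Being a set and not a family of sequences, it
  absorbs walks that merge or close up.\<close>

inductive_set closure_until :: "('a \<Rightarrow> 'a) \<Rightarrow> 'a set \<Rightarrow> 'a set \<Rightarrow> 'a set" for f V F where
  start: "v \<in> V \<Longrightarrow> v \<in> closure_until f V F"
| step: "j \<in> closure_until f V F \<Longrightarrow> j \<notin> F \<Longrightarrow> f j \<in> closure_until f V F"

text \<open>
  The fibres are renamed so that \<open>a\<^sub>i b\<^sub>i\<close>, \<open>b\<^sub>i c\<^sub>i\<close>, \<open>x\<^sub>i a\<^sub>i\<close> and \<open>y\<^sub>i a\<^sub>i\<close> are edges; the remaining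
  five matchings become \<open>c\<^sub>i a\<^bsub>\<tau> i\<^esub>\<close>, \<open>x\<^sub>i b\<^bsub>\<rho> (\<pi> i)\<^esub>\<close>, \<open>y\<^sub>i b\<^bsub>\<rho> i\<^esub>\<close>, \<open>x\<^sub>i c\<^bsub>\<gamma> i\<^esub>\<close> and \<open>y\<^sub>i c\<^bsub>\<gamma>' i\<^esub>\<close>.
  With this parametrisation the walk that alternates between the fibres of \<open>a\<close> and \<open>b\<close> through
  those of \<open>x\<close> and \<open>y\<close> is governed by \<open>\<pi>\<close> alone, so \<open>\<rho>\<close> stays independent of it.
\<close>
definition reindexed_colouring where
  "reindexed_colouring h \<tau> \<pi> \<rho> \<gamma> \<gamma>' ca cb cc cx cy \<longleftrightarrow>
    (\<forall>i::nat. ca i < (3::nat) \<and> cb i < 3 \<and> cc i < 3 \<and> cx i < 3 \<and> cy i < 3) \<and>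
    (\<forall>i\<in>{1..h}. ca i \<noteq> cb i \<and> cb i \<noteq> cc i \<and> cc i \<noteq> ca (\<tau> i) \<and>
       cx i \<noteq> ca i \<and> cx i \<noteq> cb (\<rho> (\<pi> i)) \<and> cx i \<noteq> cc (\<gamma> i) \<and>
       cy i \<noteq> ca i \<and> cy i \<noteq> cb (\<rho> i) \<and> cy i \<noteq> cc (\<gamma>' i))"

text \<open>Walks along \<open>\<pi>\<close> inspect the triples of the x-fibre, walks along
  \<open>inv \<pi>\<close> those of the y-fibre. As \<open>cb\<close> negates the sign and
  \<open>cc\<close> keeps it, unequal signs mean equal colours at the other two neighbours, and the
  walk may stop. Otherwise the b-neighbour \<open>\<rho> (\<pi> j)\<close> takes the third colour;
  it also lies in the y-triple of \<open>\<pi> j\<close>, which is repaired at its a-vertex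
  \<open>\<pi> j\<close>. By \<open>disj\<close> no edge between the fibres of a and b gets the
  third colour at both ends.\<close>

lemma ex_reindexed_colouring:
  fixes s :: "nat \<Rightarrow> bool"
  assumes pi: "\<pi> permutes {1..h}" and rho: "\<rho> permutes {1..h}"
    and s: "\<And>i. i \<in> {1..h} \<Longrightarrow> \<tau> i \<notin> V \<Longrightarrow> s (\<tau> i) \<noteq> s i"
    and S: "S = closure_until \<pi> V {j. s (\<gamma> j) \<noteq> s (\<rho> (\<pi> j))}
              \<union> closure_until (inv \<pi>) V {j. s (\<gamma>' j) \<noteq> s (\<rho> j)}"
    and disj: "S \<inter> \<rho> ` S = {}"
  shows "\<exists>ca cb cc cx cy. reindexed_colouring h \<tau> \<pi> \<rho> \<gamma> \<gamma>' ca cb cc cx cy"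
proof -
  define F where "F = {j. s (\<gamma> j) \<noteq> s (\<rho> (\<pi> j))}"
  define G where "G = {j. s (\<gamma>' j) \<noteq> s (\<rho> j)}"
  define fw where "fw = closure_until \<pi> V F"
  define bw where "bw = closure_until (inv \<pi>) V G"
  note cl = closure_until.intros
  have S': "S = fw \<union> bw" by (simp add: S fw_def bw_def F_def G_def)
  \<comment> \<open>\<open>S\<close> and \<open>T\<close> are the indices at which the fibres of \<open>a\<close> and \<open>b\<close> receive the third colour. A triple
    with two third colours is never rainbow; one with exactly one is where a walk stopped, that is,
    its other two colours agree.\<close>
  define T where "T = (\<lambda>j. \<rho> (\<pi> j)) ` (fw - F) \<union> \<rho> ` (bw - G)"
  have inj: "\<rho> i = \<rho> j \<longleftrightarrow> i = j" "\<pi> i = \<pi> j \<longleftrightarrow> i = j" for i j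
    using permutes_inj[OF rho] permutes_inj[OF pi] by (auto dest: injD)
  have inv[simp]: "\<pi> (inv \<pi> j) = j" "inv \<pi> (\<pi> j) = j" for j
    using permutes_inverses[OF pi] by auto
  have VS: "V \<subseteq> fw" "V \<subseteq> bw" by (auto simp: fw_def bw_def intro: cl)
  have fw_step: "\<pi> j \<in> fw" if "j \<in> fw" "j \<notin> F" for j using that unfolding fw_def by (rule cl)
  have bw_step: "inv \<pi> j \<in> bw" if "j \<in> bw" "j \<notin> G" for j using that unfolding bw_def by (rule cl)
  have fw_cases: "j \<in> V \<or> (\<exists>i\<in>fw - F. j = \<pi> i)" if "j \<in> fw" for j
    using that unfolding fw_def by (cases rule: closure_until.cases) auto
  have bw_cases: "j \<in> V \<or> (\<exists>i\<in>bw - G. j = inv \<pi> i)" if "j \<in> bw" for j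
    using that unfolding bw_def by (cases rule: closure_until.cases) auto
  have "T \<subseteq> \<rho> ` S" unfolding T_def S' using fw_step by blast
  with disj have ST: "S \<inter> T = {}" by blast
  define ca where "ca = (\<lambda>i. if i \<in> S then 2 else if s i then 1 else 0 :: nat)"
  define cb where "cb = (\<lambda>i. if i \<in> T then 2 else if s i then 0 else 1 :: nat)"
  define cc where "cc = (\<lambda>i. if s i then 1 else 0 :: nat)"
  \<comment> \<open>A point outside \<open>fw\<close> was entered by a backward walk, which came
    through the b-neighbour \<open>\<rho> (\<pi> j)\<close>; so that neighbour is in
    \<open>T\<close>.\<close>
  have X: "j \<in> S \<Longrightarrow> \<rho> (\<pi> j) \<notin> T \<Longrightarrow> j \<in> F" for j
  proof -
    assume j: "j \<in> S" "\<rho> (\<pi> j) \<notin> T"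
    have "j \<in> fw"
    proof (rule ccontr)
      assume "j \<notin> fw"
      then have "j \<in> bw" "j \<notin> V" using j S' VS by auto
      then obtain i where "i \<in> bw - G" "j = inv \<pi> i" using bw_cases by blast
      then have "\<rho> (\<pi> j) \<in> T" by (auto simp: T_def)
      with j show False by simp
    qed
    then show "j \<in> F" using j by (auto simp: T_def)
  qed
  have X': "\<rho> (\<pi> j) \<in> T \<Longrightarrow> j \<in> S" for j
    using bw_step by (fastforce simp: T_def S' inj)
  have Y: "j \<in> S \<Longrightarrow> \<rho> j \<notin> T \<Longrightarrow> j \<in> G" for j
  proof -
    assume j: "j \<in> S" "\<rho> j \<notin> T"
    have "j \<in> bw"
    proof (rule ccontr)
      assume "j \<notin> bw"
      then have "j \<in> fw" "j \<notin> V" using j S' VS by auto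
      then obtain i where "i \<in> fw - F" "j = \<pi> i" using fw_cases by blast
      then have "\<rho> j \<in> T" by (auto simp: T_def)
      with j show False by simp
    qed
    then show "j \<in> G" using j by (auto simp: T_def)
  qed
  have Y': "\<rho> j \<in> T \<Longrightarrow> j \<in> S" for j
    using fw_step by (fastforce simp: T_def S' inj)
  have lt: "ca i < 3" "cb i < 3" "cc i < 3" for i by (auto simp: ca_def cb_def cc_def)
  \<comment> \<open>Third colour at both a and b: two neighbours agree. At a only: \<open>X\<close>
    puts \<open>j\<close> into \<open>F\<close>. At b only: excluded by \<open>X'\<close>. At
    neither: three vertices share two colours.\<close>
  have "\<exists>t<3. t \<noteq> ca j \<and> t \<noteq> cb (\<rho> (\<pi> j)) \<and> t \<noteq> cc (\<gamma> j)" for j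
    by (intro ex_colour_avoiding lt) (use X[of j] X'[of j] in \<open>auto simp: ca_def cb_def cc_def F_def\<close>)
  then obtain cx where cx: "\<And>j. cx j < 3 \<and> cx j \<noteq> ca j \<and> cx j \<noteq> cb (\<rho> (\<pi> j)) \<and> cx j \<noteq> cc (\<gamma> j)"
    by metis
  have "\<exists>t<3. t \<noteq> ca j \<and> t \<noteq> cb (\<rho> j) \<and> t \<noteq> cc (\<gamma>' j)" for j
    by (intro ex_colour_avoiding lt) (use Y[of j] Y'[of j] in \<open>auto simp: ca_def cb_def cc_def G_def\<close>)
  then obtain cy where cy: "\<And>j. cy j < 3 \<and> cy j \<noteq> ca j \<and> cy j \<noteq> cb (\<rho> j) \<and> cy j \<noteq> cc (\<gamma>' j)"
    by metis
  have "ca i \<noteq> cb i" for i using ST by (auto simp: ca_def cb_def)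
  moreover have "cb i \<noteq> cc i" for i by (auto simp: cb_def cc_def)
  moreover have "cc i \<noteq> ca (\<tau> i)" if "i \<in> {1..h}" for i
    using s[OF that] VS S' by (auto simp: ca_def cc_def)
  ultimately have "reindexed_colouring h \<tau> \<pi> \<rho> \<gamma> \<gamma>' ca cb cc cx cy"
    using cx cy lt unfolding reindexed_colouring_def by blast
  then show ?thesis by blast
qed

section \<open>Orbit minima\<close>

text \<open>For a permutation of a finite set \<open>A\<close> this picks one point from every
  cycle, fixed points included, so its cardinality is the number of cycles. These points, on even
  cycles as well as on odd ones, are where the third colour is first placed.\<close>

definition orbit_minima :: "('a::linorder \<Rightarrow> 'a) \<Rightarrow> 'a set \<Rightarrow> 'a set" where
  "orbit_minima f A = {i \<in> A. \<forall>k. i \<le> (f ^^ k) i}"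

lemma orbit_minima_subset: "orbit_minima f A \<subseteq> A"
  by (auto simp: orbit_minima_def)

text \<open>The sign is the parity of the distance from the least element of the cycle. One step of
  \<open>\<tau>\<close> raises this distance by one, except on returning to the minimum.\<close>

lemma alternating_signs_off_orbit_minima:
  fixes \<tau> :: "nat \<Rightarrow> nat"
  assumes tau: "\<tau> permutes {1..h}"
  obtains s :: "nat \<Rightarrow> bool" where
    "\<And>i. i \<in> {1..h} \<Longrightarrow> \<tau> i \<notin> orbit_minima \<tau> {1..h} \<Longrightarrow> s (\<tau> i) \<noteq> s i"
proof -
  have perm: "permutation \<tau>" using tau permutation_permutes by blast
  define m where "m i = (LEAST x. x \<in> orbit \<tau> i)" for i
  define s where "s i = even (funpow_dist \<tau> (m i) i)" for i
  have self: "i \<in> orbit \<tau> i" for i by (rule permutation_self_in_orbit[OF perm])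
  have m: "m i \<in> orbit \<tau> i" for i unfolding m_def by (rule LeastI[OF self])
  have "s (\<tau> i) \<noteq> s i" if i: "i \<in> {1..h}" and nV: "\<tau> i \<notin> orbit_minima \<tau> {1..h}" for i
  proof -
    have "orbit \<tau> (\<tau> i) = orbit \<tau> i"
      using permutation_orbit_step[OF perm] by blast
    then have meq: "m (\<tau> i) = m i" by (simp add: m_def)
    define k where "k = funpow_dist \<tau> (m i) i"
    define k' where "k' = funpow_dist \<tau> (m i) (\<tau> i)"
    have im: "i \<in> orbit \<tau> (m i)" using m[of i] self orbit_swap by metis
    have k: "(\<tau> ^^ k) (m i) = i" unfolding k_def by (rule funpow_dist_prop[OF im])
    have im': "\<tau> i \<in> orbit \<tau> (m i)" using im by (rule orbit.step)
    have k': "(\<tau> ^^ k') (m i) = \<tau> i" unfolding k'_def by (rule funpow_dist_prop[OF im'])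
    have "k' \<noteq> 0"
    proof
      assume "k' = 0"
      then have "\<tau> i = m (\<tau> i)" using k' meq by simp
      then have "\<tau> i \<le> x" if "x \<in> orbit \<tau> (\<tau> i)" for x
        using that unfolding m_def by (metis Least_le)
      moreover have "(\<tau> ^^ k) (\<tau> i) \<in> orbit \<tau> (\<tau> i)" for k
        using self funpow_in_orbit by metis
      moreover have "\<tau> i \<in> {1..h}" using permutes_in_image[OF tau] i by blast
      ultimately have "\<tau> i \<in> orbit_minima \<tau> {1..h}" by (auto simp: orbit_minima_def)
      with nV show False by simp
    qed
    then obtain l where l: "k' = Suc l" by (cases k') auto
    have "\<tau> ((\<tau> ^^ l) (m i)) = \<tau> i" using k' l by simp
    then have "(\<tau> ^^ l) (m i) = i" using permutes_inj[OF tau] by (auto dest: injD)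
    \<comment> \<open>Minimality of both distances: dropping the last step of a path to
      \<open>\<tau> i\<close> gives a path to \<open>i\<close>, and appending a step does the
      converse.\<close>
    then have "k \<le> l" unfolding k_def funpow_dist_def by (rule Least_le)
    moreover have "k' \<le> Suc k" unfolding k'_def funpow_dist_def by (rule Least_le) (simp add: k)
    ultimately have "k' = Suc k" using l by simp
    then show ?thesis by (simp add: s_def meq k_def k'_def)
  qed
  then show ?thesis using that by blast
qed

text \<open>Outside \<open>V\<close>, \<open>\<tau>\<close> sends one sign injectively into the
  other. Hence neither sign covers much more than half of the indices, which makes an inspection
  fail with probability about one half.\<close>

lemma card_sign_class_le:
  fixes s :: "nat \<Rightarrow> bool"
  assumes tau: "\<tau> permutes {1..h}" and V: "V \<subseteq> {1..h}"
    and s: "\<And>i. i \<in> {1..h} \<Longrightarrow> \<tau> i \<notin> V \<Longrightarrow> s (\<tau> i) \<noteq> s i"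
  shows "2 * card {i \<in> {1..h}. s i = z} \<le> h + card V"
proof -
  let ?P = "{i \<in> {1..h}. s i = z}" and ?N = "{i \<in> {1..h}. s i \<noteq> z}"
  have fV: "finite V" using V finite_subset by blast
  have "\<tau> ` ?P \<subseteq> ?N \<union> V" using s permutes_in_image[OF tau] by auto
  then have "card (\<tau> ` ?P) \<le> card (?N \<union> V)" by (intro card_mono) (auto simp: fV)
  also have "\<dots> \<le> card ?N + card V" by (rule card_Un_le)
  also have "card (\<tau> ` ?P) = card ?P"
    by (intro card_image inj_on_subset[OF permutes_inj[OF tau]]) auto
  finally have "card ?P \<le> card ?N + card V" .
  moreover have "card ?P + card ?N = h"
  proof -
    have "card ?P + card ?N = card (?P \<union> ?N)" by (intro card_Un_disjoint[symmetric]) auto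
    also have "?P \<union> ?N = {1..h}" by auto
    finally show ?thesis by simp
  qed
  ultimately show ?thesis by linarith
qed

text \<open>Composing with the transposition inserts \<open>n\<close> into the cycle of
  \<open>b\<close>, just before \<open>b\<close>, or as a fixed point if \<open>b = n\<close>. Since
  \<open>n\<close> exceeds all of \<open>A\<close>, no old cycle changes its minimum.\<close>

lemma orbit_minima_transpose_insert:
  assumes p: "p permutes A" and max: "\<And>i. i \<in> A \<Longrightarrow> i < n" and b: "b \<in> insert n A"
  shows "orbit_minima (Transposition.transpose n b \<circ> p) (insert n A)
           = orbit_minima p A \<union> (if b = n then {n} else {})"
proof -
  let ?q = "Transposition.transpose n b \<circ> p"
  have nA: "n \<notin> A" using max by blast
  have pn: "p n = n" using p nA by (rule permutes_not_in)
  have qn: "?q n = b" by (simp add: pn)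
  have stay: "(p ^^ k) i \<in> A" if "i \<in> A" for i k
    using that by (induction k) (auto simp: permutes_in_image[OF p])
  have qstep: "?q j = (if p j = b then n else p j)" if "j \<in> A" for j
    using that nA permutes_in_image[OF p, of j] by (auto simp: Transposition.transpose_def)
  have 1: "\<exists>l. (p ^^ k) i = (?q ^^ l) i" if "i \<in> A" for i k
  proof (induction k)
    case 0 show ?case by (rule exI[of _ 0]) simp
  next
    case (Suc k)
    then obtain l where l: "(p ^^ k) i = (?q ^^ l) i" by blast
    show ?case
    proof (cases "p ((p ^^ k) i) = b")
      case False
      then have "(p ^^ Suc k) i = (?q ^^ Suc l) i"
        using qstep[OF stay[OF that, of k]] l by simp
      then show ?thesis by blast
    next
      case True
      then have "(?q ^^ Suc l) i = n"
        using qstep[OF stay[OF that, of k]] l by simp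
      then have "(?q ^^ Suc (Suc l)) i = b" using qn by simp
      then show ?thesis using True by (metis funpow.simps(2) o_apply)
    qed
  qed
  \<comment> \<open>The case of \<open>n\<close> also records that \<open>b\<close>, the next point
    after \<open>n\<close>, is on the old orbit; without this the induction could not leave
    \<open>n\<close>.\<close>
  have 2: "(?q ^^ k) i = n \<and> b \<noteq> n \<and> (\<exists>l. b = (p ^^ l) i) \<or> (\<exists>l. (?q ^^ k) i = (p ^^ l) i)" if "i \<in> A" for i k
  proof (induction k)
    case 0 have "(?q ^^ 0) i = (p ^^ 0) i" by simp
    then show ?case by blast
  next
    case (Suc k)
    then consider "(?q ^^ k) i = n" "\<exists>l. b = (p ^^ l) i" | l where "(?q ^^ k) i = (p ^^ l) i" by blast
    then show ?case
    proof cases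
      case 1
      have "(?q ^^ Suc k) i = b" by (metis 1(1) qn funpow.simps(2) o_apply)
      then show ?thesis using 1(2) by metis
    next
      case 2
      have *: "p ((p ^^ l) i) = (p ^^ Suc l) i" by simp
      have A: "(p ^^ Suc l) i \<in> A" by (rule stay[OF that])
      have "(?q ^^ Suc k) i = (if (p ^^ Suc l) i = b then n else (p ^^ Suc l) i)"
        using 2 qstep[OF stay[OF that, of l]] by simp
      then show ?thesis using A nA by (metis (full_types))
    qed
  qed
  have "(\<forall>k. i \<le> (?q ^^ k) i) \<longleftrightarrow> (\<forall>k. i \<le> (p ^^ k) i)" if "i \<in> A" for i
    using 1[OF that] 2[OF that] max[OF that] by (metis less_imp_le)
  moreover have "(\<forall>k. n \<le> (?q ^^ k) n) \<longleftrightarrow> b = n"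
  proof
    assume "\<forall>k. n \<le> (?q ^^ k) n"
    then have "n \<le> (?q ^^ 1) n" by blast
    then have "n \<le> b" using qn by simp
    then show "b = n" using b max by fastforce
  next
    assume "b = n"
    then have "?q n = n" using qn by simp
    then have "(?q ^^ k) n = n" for k by (induction k) auto
    then show "\<forall>k. n \<le> (?q ^^ k) n" by simp
  qed
  ultimately show ?thesis unfolding orbit_minima_def by auto
qed

text \<open>The mean number of cycles is the harmonic number. Each permutation of \<open>n\<close>
  points extends in \<open>Suc n\<close> ways, exactly one of which creates a new cycle.\<close>

lemma sum_card_orbit_minima:
  "(\<Sum>\<tau> | \<tau> permutes {1..n::nat}. real (card (orbit_minima \<tau> {1..n}))) = fact n * harm n"
proof (induction n)
  case 0
  show ?case by (simp add: orbit_minima_def harm_expand)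
next
  case (Suc n)
  let ?P = "{p. p permutes {1..n}}"
  have ins: "{1..Suc n} = insert (Suc n) {1..n}" by auto
  have card: "card (orbit_minima (Transposition.transpose (Suc n) b \<circ> p) {1..Suc n})
        = card (orbit_minima p {1..n}) + (if b = Suc n then 1 else 0)"
    if "p permutes {1..n}" "b \<in> {1..Suc n}" for p b
  proof -
    have "orbit_minima (Transposition.transpose (Suc n) b \<circ> p) {1..Suc n}
        = orbit_minima p {1..n} \<union> (if b = Suc n then {Suc n} else {})"
      unfolding ins by (rule orbit_minima_transpose_insert) (use that in auto)
    moreover have "Suc n \<notin> orbit_minima p {1..n}" "finite (orbit_minima p {1..n})"
      using orbit_minima_subset[of p "{1..n}"] finite_subset by auto
    ultimately show ?thesis by simp
  qed
  have "(\<Sum>\<tau> | \<tau> permutes {1..Suc n}. real (card (orbit_minima \<tau> {1..Suc n})))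
      = (\<Sum>b\<in>{1..Suc n}. \<Sum>p\<in>?P. real (card (orbit_minima (Transposition.transpose (Suc n) b \<circ> p) {1..Suc n})))"
    unfolding ins by (rule sum_over_permutations_insert) auto
  also have "\<dots> = (\<Sum>b\<in>{1..Suc n}. \<Sum>p\<in>?P. real (card (orbit_minima p {1..n})) + (if b = Suc n then 1 else 0))"
    by (intro sum.cong refl) (use card in auto)
  also have "\<dots> = (\<Sum>b\<in>{1..Suc n}. fact n * harm n + fact n * (if b = Suc n then 1 else 0))"
    by (simp only: sum.distrib Suc.IH) (simp add: card_permutations)
  also have "\<dots> = real (Suc n) * (fact n * harm n) + fact n"
    by (simp add: sum.distrib sum_distrib_left[symmetric])
  also have "\<dots> = fact (Suc n) * harm (Suc n)"
    by (simp add: harm_Suc field_simps)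
  finally show ?case .
qed

section \<open>Uniform random permutations\<close>

text \<open>Fix the image \<open>b\<close> of one point of \<open>X\<close>, in at most
  \<open>m\<close> ways, and cancel it by a transposition. The remaining target sets are carried
  along by that transposition and do not grow, so the induction ranges over all \<open>A\<close> and
  \<open>B\<close>.\<close>

lemma card_permutes_into_le:
  assumes "finite A" "X \<subseteq> A" and B: "\<And>u. u \<in> X \<Longrightarrow> finite (B u) \<and> card (B u) \<le> m"
  shows "card {p. p permutes A \<and> (\<forall>u\<in>X. p u \<in> B u)} \<le> m ^ card X * fact (card A - card X)"
proof -
  have "finite X" using assms finite_subset by blast
  then show ?thesis using assms
  proof (induction X arbitrary: A B rule: finite_induct)
    case empty
    then show ?case by (simp add: card_permutations)
  next
    case (insert a X)
    define A' where "A' = A - {a}"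
    have A: "A = insert a A'" "a \<notin> A'" "finite A'" using insert.prems by (auto simp: A'_def)
    have XA: "X \<subseteq> A'" using insert by (auto simp: A'_def)
    define C where "C b = {p. p permutes A' \<and> (\<forall>u\<in>X. p u \<in> Transposition.transpose a b ` B u)}" for b
    have fin: "finite (C b)" for b
      unfolding C_def by (rule finite_subset[OF _ finite_permutations[OF A(3)]]) auto
    have "{p. p permutes A \<and> (\<forall>u\<in>insert a X. p u \<in> B u)}
        \<subseteq> (\<Union>b\<in>B a. (\<lambda>q. Transposition.transpose a b \<circ> q) ` C b)"
    proof
      fix p assume "p \<in> {p. p permutes A \<and> (\<forall>u\<in>insert a X. p u \<in> B u)}"
      then have p: "p permutes insert a A'" "p a \<in> B a" "\<forall>u\<in>X. p u \<in> B u" using A by auto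
      define q where "q = Transposition.transpose a (p a) \<circ> p"
      have "q permutes A'" unfolding q_def by (rule permutes_insert_lemma[OF p(1)])
      then have "q \<in> C (p a)" using p(3) by (auto simp: C_def q_def)
      moreover have "p = Transposition.transpose a (p a) \<circ> q" by (simp add: q_def o_assoc)
      ultimately show "p \<in> (\<Union>b\<in>B a. (\<lambda>q. Transposition.transpose a b \<circ> q) ` C b)" using p(2) by blast
    qed
    then have "card {p. p permutes A \<and> (\<forall>u\<in>insert a X. p u \<in> B u)}
        \<le> card (\<Union>b\<in>B a. (\<lambda>q. Transposition.transpose a b \<circ> q) ` C b)"
      by (rule card_mono[rotated]) (use insert.prems fin in auto)
    also have "\<dots> \<le> (\<Sum>b\<in>B a. card ((\<lambda>q. Transposition.transpose a b \<circ> q) ` C b))"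
      using insert.prems by (intro card_UN_le) auto
    also have "\<dots> \<le> (\<Sum>b\<in>B a. m ^ card X * fact (card A' - card X))"
    proof (rule sum_mono)
      fix b
      have "card ((\<lambda>q. Transposition.transpose a b \<circ> q) ` C b) \<le> card (C b)" by (rule card_image_le[OF fin])
      also have "\<dots> \<le> m ^ card X * fact (card A' - card X)"
        unfolding C_def by (rule insert.IH[OF A(3) XA]) (use insert.prems(3) in \<open>auto intro: order_trans[OF card_image_le]\<close>)
      finally show "card ((\<lambda>q. Transposition.transpose a b \<circ> q) ` C b) \<le> m ^ card X * fact (card A' - card X)" .
    qed
    also have "\<dots> = card (B a) * (m ^ card X * fact (card A' - card X))" by simp
    also have "\<dots> \<le> m * (m ^ card X * fact (card A' - card X))"
      using insert.prems(3)[of a] by (intro mult_right_mono) auto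
    also have "\<dots> = m ^ card (insert a X) * fact (card A - card (insert a X))"
      using insert.hyps A by simp
    finally show ?case .
  qed
qed

lemma power_mult_fact_le_fact: "m ^ d * fact m \<le> (fact (m + d) :: nat)"
proof (induction d)
  case (Suc d)
  have "m ^ Suc d * fact m = m * (m ^ d * fact m)" by simp
  also have "\<dots> \<le> Suc (m + d) * fact (m + d)" by (intro mult_mono Suc.IH) auto
  finally show ?case by simp
qed simp

abbreviation uniform_perm :: "'a set \<Rightarrow> ('a \<Rightarrow> 'a) pmf" where
  "uniform_perm A \<equiv> pmf_of_set {p. p permutes A}"

lemma permutations_nonempty: "{p. p permutes A} \<noteq> {}"
  using permutes_id[of A] by blast

lemma set_uniform_perm: "finite A \<Longrightarrow> set_pmf (uniform_perm A) = {p. p permutes A}"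
  by (rule set_pmf_of_set[OF permutations_nonempty finite_permutations])

lemma prob_uniform_perm:
  "finite A \<Longrightarrow> measure_pmf.prob (uniform_perm A) E = card {p. p permutes A \<and> p \<in> E} / fact (card A)"
  using measure_pmf_of_set[OF permutations_nonempty finite_permutations, of A E]
  by (simp add: card_permutations Int_def)

text \<open>The bound has the form it would have for independent draws: in the quotient of
  factorials every factor is at least \<open>card A - card X\<close>.\<close>

lemma prob_uniform_perm_into_le:
  assumes A: "finite A" "X \<subseteq> A" "card X < card A"
    and B: "\<And>u. u \<in> X \<Longrightarrow> finite (B u) \<and> card (B u) \<le> m"
  shows "measure_pmf.prob (uniform_perm A) {p. \<forall>u\<in>X. p u \<in> B u}
           \<le> (real m / real (card A - card X)) ^ card X"
proof -
  define d n where "d = card X" and "n = card A - card X"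
  have n: "n > 0" "card A = n + d" using A by (auto simp: d_def n_def)
  have "real (card {p. p permutes A \<and> (\<forall>u\<in>X. p u \<in> B u)}) \<le> real (m ^ d * fact n)"
    unfolding d_def n_def of_nat_le_iff by (rule card_permutes_into_le) (use A B in auto)
  moreover have "real n ^ d * fact n \<le> fact (n + d)"
  proof -
    have "real (n ^ d * fact n) \<le> real (fact (n + d))"
      by (subst of_nat_le_iff) (rule power_mult_fact_le_fact)
    then show ?thesis by simp
  qed
  ultimately have "real (card {p. p permutes A \<and> (\<forall>u\<in>X. p u \<in> B u)}) / fact (n + d)
      \<le> (m ^ d * fact n) / (real n ^ d * fact n)"
    using n by (intro frac_le) auto
  also have "\<dots> = (real m / real n) ^ d" by (simp add: power_divide)
  finally show ?thesis
    unfolding n(2)[symmetric] prob_uniform_perm[OF A(1)] mem_Collect_eq unfolding d_def n_def .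
qed

text \<open>Markov's inequality for the number of cycles.\<close>

lemma prob_card_orbit_minima_ge:
  assumes "K > 0"
  shows "measure_pmf.prob (uniform_perm {1..h}) {\<tau>. K \<le> card (orbit_minima \<tau> {1..h})} \<le> harm h / real K"
proof -
  let ?c = "\<lambda>\<tau>. card (orbit_minima \<tau> {1..h})"
  let ?S = "{\<tau>. \<tau> permutes {1..h} \<and> K \<le> ?c \<tau>}"
  have fin: "finite {\<tau>. \<tau> permutes {1..h}}" by (simp add: finite_permutations)
  have "real (card ?S) * K = (\<Sum>\<tau>\<in>?S. real K)" by simp
  also have "\<dots> \<le> (\<Sum>\<tau>\<in>?S. real (?c \<tau>))" by (intro sum_mono) auto
  also have "\<dots> \<le> (\<Sum>\<tau> | \<tau> permutes {1..h}. real (?c \<tau>))"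
    by (intro sum_mono2 fin) auto
  also have "\<dots> = fact h * harm h" by (rule sum_card_orbit_minima)
  finally show ?thesis using assms by (simp add: prob_uniform_perm field_simps)
qed

section \<open>Revealing random choices one after another\<close>

lemma prob_mono_on_support:
  assumes "\<And>x. x \<in> set_pmf p \<Longrightarrow> x \<in> A \<Longrightarrow> x \<in> B"
  shows "measure_pmf.prob p A \<le> measure_pmf.prob p B"
  by (rule measure_pmf.finite_measure_mono_AE) (use assms in \<open>auto simp: AE_measure_pmf_iff\<close>)

text \<open>Union bound for a two-stage experiment: either the first stage hits the bad set
  \<open>B\<close>, or the second stage fails with conditional probability at most
  \<open>c\<close>.\<close>

lemma prob_bind_pmf_le:
  assumes "measure_pmf.prob p B \<le> e" "0 \<le> c"
    and f: "\<And>x. x \<in> set_pmf p \<Longrightarrow> x \<notin> B \<Longrightarrow> measure_pmf.prob (f x) A \<le> c"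
  shows "measure_pmf.prob (bind_pmf p f) A \<le> e + c"
proof -
  have e: "0 \<le> e" using assms(1) measure_nonneg order_trans by blast
  have "emeasure (bind_pmf p f) A = (\<integral>\<^sup>+x. emeasure (f x) A \<partial>p)"
    by (rule emeasure_bind_pmf)
  also have "\<dots> \<le> (\<integral>\<^sup>+x. indicator B x + ennreal c \<partial>p)"
  proof (rule nn_integral_mono_AE, rule AE_pmfI)
    fix x assume x: "x \<in> set_pmf p"
    show "emeasure (f x) A \<le> indicator B x + ennreal c"
    proof (cases "x \<in> B")
      case True
      have "emeasure (f x) A \<le> 1" by (rule measure_pmf.emeasure_le_1)
      also have "\<dots> \<le> 1 + ennreal c" by simp
      finally show ?thesis using True by simp
    next
      case False
      then have "measure_pmf.prob (f x) A \<le> c" by (rule f[OF x])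
      then show ?thesis using False by (simp add: measure_pmf.emeasure_eq_measure ennreal_leI)
    qed
  qed
  also have "\<dots> = emeasure p B + ennreal c"
    by (subst nn_integral_add) (auto simp: measure_pmf.emeasure_space_1)
  also have "\<dots> \<le> ennreal (e + c)"
    using assms(1,2) e by (simp add: measure_pmf.emeasure_eq_measure ennreal_leI)
  finally have "ennreal (measure_pmf.prob (bind_pmf p f) A) \<le> ennreal (e + c)"
    by (simp only: measure_pmf.emeasure_eq_measure)
  then show ?thesis using assms(2) e by (subst (asm) ennreal_le_iff) auto
qed

section \<open>Walks cut off after \<open>d\<close> steps\<close>

definition iterates :: "nat \<Rightarrow> ('a \<Rightarrow> 'a) \<Rightarrow> 'a set \<Rightarrow> 'a set" where
  "iterates d f V = (\<Union>v\<in>V. (\<lambda>t. (f ^^ t) v) ` {..<d})"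

lemma card_iterates_le: "finite V \<Longrightarrow> card (iterates d f V) \<le> card V * d"
proof -
  assume "finite V"
  then have "card (iterates d f V) \<le> (\<Sum>v\<in>V. card ((\<lambda>t. (f ^^ t) v) ` {..<d}))"
    unfolding iterates_def by (rule card_UN_le)
  also have "\<dots> \<le> (\<Sum>v\<in>V. d)" by (intro sum_mono order_trans[OF card_image_le]) auto
  finally show ?thesis by simp
qed

lemma funpow_permutes_in: "f permutes A \<Longrightarrow> v \<in> A \<Longrightarrow> (f ^^ t) v \<in> A"
  by (induction t) (auto simp: permutes_in_image)

lemma iterates_subset: "f permutes A \<Longrightarrow> V \<subseteq> A \<Longrightarrow> iterates d f V \<subseteq> A"
  by (auto simp: iterates_def funpow_permutes_in)

text \<open>The hypothesis on \<open>V\<close> is confined to starts with \<open>d\<close> distinct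
  iterates because only there does the later probability bound obtain \<open>d\<close> separate
  constraints.\<close>

lemma closure_until_subset_iterates:
  assumes f: "inj f" and d: "d > 0"
    and V: "\<And>v. v \<in> V \<Longrightarrow> inj_on (\<lambda>t. (f ^^ t) v) {..<d} \<Longrightarrow> \<exists>t<d. (f ^^ t) v \<in> F"
  shows "closure_until f V F \<subseteq> iterates d f V"
proof
  fix j assume "j \<in> closure_until f V F"
  \<comment> \<open>Recording that all earlier points avoid \<open>F\<close> is what contradicts the
    hypothesis on \<open>V\<close> if a walk without repetition reaches time
    \<open>d\<close>.\<close>
  then have "\<exists>v\<in>V. \<exists>t<d. j = (f ^^ t) v \<and> (\<forall>r<t. (f ^^ r) v \<notin> F)"
  proof induction
    case (start v)
    show ?case by (rule bexI[OF _ start], rule exI[of _ 0]) (use d in auto)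
  next
    case (step j)
    then obtain v t where v: "v \<in> V" "t < d" "j = (f ^^ t) v" "\<And>r. r < t \<Longrightarrow> (f ^^ r) v \<notin> F"
      by blast
    have F: "(f ^^ r) v \<notin> F" if "r < Suc t" for r
      using that v step by (cases "r = t") auto
    have fj: "f j = (f ^^ Suc t) v" using v by simp
    show ?case
    proof (cases "Suc t < d")
      case True
      then show ?thesis using v(1) fj F by blast
    next
      case False
      then have d: "d = Suc t" using v by simp
      then have "\<not> inj_on (\<lambda>t. (f ^^ t) v) {..<d}" using V[OF v(1)] F by blast
      then have "\<exists>a b. a < b \<and> b < d \<and> (f ^^ a) v = (f ^^ b) v"
        unfolding inj_on_def by (metis lessThan_iff linorder_neqE_nat)
      then obtain a b where ab: "a < b" "b < d" "(f ^^ a) v = (f ^^ b) v" by blast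
      \<comment> \<open>A walk that closes up before time \<open>d\<close> never needs to stop.\<close>
      have "(f ^^ b) v = (f ^^ a) ((f ^^ (b - a)) v)" 
        using ab(1) by (metis add_diff_inverse_nat funpow_add less_imp_le_nat not_le o_apply)
      then have per: "(f ^^ (b - a)) v = v"
        using ab(3) inj_fn[OF f, of a] by (metis injD)
      have "(f ^^ d) v = (f ^^ (d - (b - a))) ((f ^^ (b - a)) v)"
        using ab by (metis diff_le_self funpow_add le_add_diff_inverse2 le_trans less_imp_le_nat o_apply)
      then have "f j = (f ^^ (d - (b - a))) v" using per fj d by simp
      moreover have "d - (b - a) < d" using ab by simp
      ultimately show ?thesis using v(1) F d by (meson less_trans)
    qed
  qed
  then show "j \<in> iterates d f V" by (auto simp: iterates_def)
qed

text \<open>A walk that escapes has visited \<open>d\<close> distinct points, and at each of them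
  \<open>\<gamma>\<close> landed in a sign class fixed beforehand by \<open>g\<close>. The sum over
  \<open>V\<close> is a union bound over the starting points.\<close>

lemma prob_closure_until_escapes:
  fixes s :: "nat \<Rightarrow> bool"
  assumes f: "f permutes {1..h}" and V: "V \<subseteq> {1..h}" and d: "0 < d" "d < h"
    and m: "\<And>z. card {i \<in> {1..h}. s i = z} \<le> m"
  shows "measure_pmf.prob (uniform_perm {1..h})
           {\<gamma>. \<not> closure_until f V {j. s (\<gamma> j) \<noteq> s (g j)} \<subseteq> iterates d f V}
         \<le> real (card V) * (real m / real (h - d)) ^ d"
proof -
  let ?U = "uniform_perm {1..h}"
  let ?X = "\<lambda>v. (\<lambda>t. (f ^^ t) v) ` {..<d}"
  let ?B = "\<lambda>u. {w \<in> {1..h}. s w = s (g u)}"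
  \<comment> \<open>Injectivity does not depend on \<open>\<gamma>\<close>; as part of the event it
    makes the starts whose iterates repeat contribute nothing.\<close>
  let ?E = "\<lambda>v. {\<gamma>. inj_on (\<lambda>t. (f ^^ t) v) {..<d} \<and> (\<forall>u\<in>?X v. \<gamma> u \<in> ?B u)}"
  have fV: "finite V" using V finite_subset by blast
  have X: "?X v \<subseteq> {1..h}" if "v \<in> V" for v
    using that V funpow_permutes_in[OF f] by blast
  have "measure_pmf.prob ?U {\<gamma>. \<not> closure_until f V {j. s (\<gamma> j) \<noteq> s (g j)} \<subseteq> iterates d f V}
      \<le> measure_pmf.prob ?U (\<Union>v\<in>V. ?E v)"
  proof (rule prob_mono_on_support)
    fix \<gamma> assume "\<gamma> \<in> set_pmf ?U"
      and esc: "\<gamma> \<in> {\<gamma>. \<not> closure_until f V {j. s (\<gamma> j) \<noteq> s (g j)} \<subseteq> iterates d f V}"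
    then have g: "\<gamma> permutes {1..h}" by (simp add: set_uniform_perm)
    from esc obtain v where v: "v \<in> V" "inj_on (\<lambda>t. (f ^^ t) v) {..<d}"
        "\<forall>t<d. s (\<gamma> ((f ^^ t) v)) = s (g ((f ^^ t) v))"
      using closure_until_subset_iterates[OF permutes_inj[OF f] d(1), of V "{j. s (\<gamma> j) \<noteq> s (g j)}"]
      by blast
    have "\<gamma> u \<in> ?B u" if u: "u \<in> ?X v" for u
    proof -
      have "u \<in> {1..h}" using u X[OF v(1)] by blast
      then have "\<gamma> u \<in> {1..h}" using permutes_in_image[OF g] by blast
      then show ?thesis using u v(3) by auto
    qed
    then show "\<gamma> \<in> (\<Union>v\<in>V. ?E v)" using v by blast
  qed
  also have "\<dots> \<le> (\<Sum>v\<in>V. measure_pmf.prob ?U (?E v))"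
    by (rule measure_pmf.finite_measure_subadditive_finite[OF fV]) simp
  also have "\<dots> \<le> (\<Sum>v\<in>V. (real m / real (h - d)) ^ d)"
  proof (rule sum_mono)
    fix v assume v: "v \<in> V"
    show "measure_pmf.prob ?U (?E v) \<le> (real m / real (h - d)) ^ d"
    proof (cases "inj_on (\<lambda>t. (f ^^ t) v) {..<d}")
      case True
      then have c: "card (?X v) = d" by (simp add: card_image)
      have "measure_pmf.prob ?U {\<gamma>. \<forall>u\<in>?X v. \<gamma> u \<in> ?B u}
          \<le> (real m / real (card {1..h} - card (?X v))) ^ card (?X v)"
        by (rule prob_uniform_perm_into_le) (use X[OF v] c d m in auto)
      then show ?thesis using True c by simp
    next
      case False
      then show ?thesis by simp
    qed
  qed
  finally show ?thesis by (simp only: sum_constant)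
qed

lemma prob_uniform_perm_image_meets_le:
  assumes W: "W \<subseteq> {1..h}" and h: "1 < h"
  shows "measure_pmf.prob (uniform_perm {1..h}) {\<rho>. W \<inter> \<rho> ` W \<noteq> {}} \<le> (real (card W))\<^sup>2 / real (h - 1)"
proof -
  let ?U = "uniform_perm {1..h}"
  have fW: "finite W" using W finite_subset by blast
  have "measure_pmf.prob ?U {\<rho>. W \<inter> \<rho> ` W \<noteq> {}}
      \<le> measure_pmf.prob ?U (\<Union>(u, w)\<in>W \<times> W. {\<rho>. \<rho> u = w})"
    by (rule measure_pmf.finite_measure_mono) auto
  also have "\<dots> \<le> (\<Sum>e\<in>W \<times> W. measure_pmf.prob ?U (case e of (u, w) \<Rightarrow> {\<rho>. \<rho> u = w}))"
    by (rule measure_pmf.finite_measure_subadditive_finite) (use fW in auto)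
  also have "\<dots> \<le> (\<Sum>e\<in>W \<times> W. 1 / real (h - 1))"
  proof (rule sum_mono, clarify)
    fix u w assume "u \<in> W" "w \<in> W"
    then show "measure_pmf.prob ?U {\<rho>. \<rho> u = w} \<le> 1 / real (h - 1)"
      \<comment> \<open>The denominator \<open>h - 1\<close> is \<open>card A - card X\<close> for a
        singleton \<open>X\<close>; the exact probability would be \<open>1 / h\<close>.\<close>
      using prob_uniform_perm_into_le[of "{1..h}" "{u}" "\<lambda>_. {w}" 1] W h by auto
  qed
  also have "\<dots> = (real (card W))\<^sup>2 / real (h - 1)"
    by (simp add: card_cartesian_product power2_eq_square)
  finally show ?thesis .
qed

text \<open>The order of revelation matters: \<open>\<tau>\<close> fixes \<open>V\<close> and the
  signs, \<open>\<pi>\<close> fixes the candidate points of the walks, \<open>\<rho>\<close> should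
  then move these off themselves, and \<open>\<gamma>\<close>, \<open>\<gamma>'\<close> decide where
  the walks stop. The error terms stand for too many cycles, a collision, and a long walk in either
  direction. The abstract \<open>P\<close> will be 3-colourability of the lift.\<close>

lemma prob_no_reindexed_colouring_le:
  assumes h: "1 < h" and d: "0 < d" "d < h" and K: "0 < K"
    and P: "\<And>\<tau> \<pi> \<rho> \<gamma> \<gamma>' ca cb cc cx cy. \<tau> permutes {1..h} \<Longrightarrow> \<pi> permutes {1..h} \<Longrightarrow>
        \<rho> permutes {1..h} \<Longrightarrow> \<gamma> permutes {1..h} \<Longrightarrow> \<gamma>' permutes {1..h} \<Longrightarrow>
        reindexed_colouring h \<tau> \<pi> \<rho> \<gamma> \<gamma>' ca cb cc cx cy \<Longrightarrow> P \<tau> \<pi> \<rho> \<gamma> \<gamma>'"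
  shows "measure_pmf.prob
     (do {\<tau> \<leftarrow> uniform_perm {1..h}; \<pi> \<leftarrow> uniform_perm {1..h}; \<rho> \<leftarrow> uniform_perm {1..h};
          \<gamma> \<leftarrow> uniform_perm {1..h}; \<gamma>' \<leftarrow> uniform_perm {1..h}; return_pmf (P \<tau> \<pi> \<rho> \<gamma> \<gamma>')}) {False}
     \<le> harm h / real K + (real (2 * d * K))\<^sup>2 / real (h - 1) + 2 * real K * (real (h + K) / real (2 * (h - d))) ^ d"
proof -
  let ?U = "uniform_perm {1..h}"
  define q where "q = real K * (real (h + K) / real (2 * (h - d))) ^ d"
  define r where "r = (real (2 * d * K))\<^sup>2 / real (h - 1)"
  have nn: "0 \<le> q" "0 \<le> r" using h by (auto simp: q_def r_def)
  have in_perm: "x permutes {1..h}" if "x \<in> set_pmf ?U" for x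
    using that by (simp add: set_uniform_perm)
  have "measure_pmf.prob
     (do {\<tau> \<leftarrow> ?U; \<pi> \<leftarrow> ?U; \<rho> \<leftarrow> ?U; \<gamma> \<leftarrow> ?U; \<gamma>' \<leftarrow> ?U; return_pmf (P \<tau> \<pi> \<rho> \<gamma> \<gamma>')}) {False}
     \<le> harm h / real K + (0 + (r + (q + (q + 0))))"
  proof (rule prob_bind_pmf_le[OF prob_card_orbit_minima_ge[OF K]])
    fix \<tau> assume tau: "\<tau> \<in> set_pmf ?U" "\<tau> \<notin> {\<tau>. K \<le> card (orbit_minima \<tau> {1..h})}"
    note tau_perm = in_perm[OF tau(1)]
    define V where "V = orbit_minima \<tau> {1..h}"
    have V: "V \<subseteq> {1..h}" unfolding V_def by (rule orbit_minima_subset)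
    then have fV: "finite V" using finite_subset by blast
    have cV: "card V \<le> K" using tau by (simp add: V_def)
    obtain s :: "nat \<Rightarrow> bool" where s: "\<And>i. i \<in> {1..h} \<Longrightarrow> \<tau> i \<notin> V \<Longrightarrow> s (\<tau> i) \<noteq> s i"
      unfolding V_def using alternating_signs_off_orbit_minima[OF tau_perm] by blast
    define m where "m = (h + K) div 2"
    have m: "card {i \<in> {1..h}. s i = z} \<le> m" for z
    proof -
      have "2 * card {i \<in> {1..h}. s i = z} \<le> h + card V"
        by (rule card_sign_class_le[OF tau_perm V]) (rule s)
      then show ?thesis using cV by (simp add: m_def)
    qed
    have q: "measure_pmf.prob ?U {\<gamma>. \<not> closure_until f V {j. s (\<gamma> j) \<noteq> s (g j)} \<subseteq> iterates d f V} \<le> q"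
      if f: "f permutes {1..h}" for f g
    proof -
      have "measure_pmf.prob ?U {\<gamma>. \<not> closure_until f V {j. s (\<gamma> j) \<noteq> s (g j)} \<subseteq> iterates d f V}
          \<le> real (card V) * (real m / real (h - d)) ^ d"
        by (rule prob_closure_until_escapes[OF f V d m])
      also have "\<dots> \<le> real K * (real (h + K) / real (2 * (h - d))) ^ d"
      proof (intro mult_mono power_mono)
        have "2 * m \<le> h + K" by (simp add: m_def)
        then have "2 * real m \<le> real h + real K" by linarith
        then show "real m / real (h - d) \<le> real (h + K) / real (2 * (h - d))"
          using divide_right_mono[of "2 * real m" "real (h + K)" "real (2 * (h - d))"] by simp
      qed (use cV in auto)
      finally show ?thesis unfolding q_def .
    qed
    show "measure_pmf.prob
       (do {\<pi> \<leftarrow> ?U; \<rho> \<leftarrow> ?U; \<gamma> \<leftarrow> ?U; \<gamma>' \<leftarrow> ?U; return_pmf (P \<tau> \<pi> \<rho> \<gamma> \<gamma>')}) {False}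
       \<le> 0 + (r + (q + (q + 0)))"
    proof (rule prob_bind_pmf_le[of _ "{}"])
      fix \<pi> assume "\<pi> \<in> set_pmf ?U"
      note pi = in_perm[OF this]
      note pi' = permutes_inv[OF pi]
      \<comment> \<open>\<open>W\<close> depends on \<open>\<tau>\<close> and \<open>\<pi>\<close>
        only, so it is a fixed set when \<open>\<rho>\<close> is drawn, unlike the set
        \<open>S\<close> that it will contain.\<close>
      define W where "W = iterates d \<pi> V \<union> iterates d (inv \<pi>) V"
      have W: "W \<subseteq> {1..h}" unfolding W_def using iterates_subset[OF pi V] iterates_subset[OF pi' V] by blast
      have "card W \<le> card V * d + card V * d"
        unfolding W_def by (rule order_trans[OF card_Un_le add_mono]) (rule card_iterates_le[OF fV])+
      also have "\<dots> \<le> K * d + K * d" using cV by (intro add_mono mult_right_mono) auto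
      finally have "card W \<le> 2 * d * K" by (simp add: algebra_simps)
      then have "(card W)\<^sup>2 \<le> (2 * d * K)\<^sup>2" by (rule power_mono) simp
      then have "real ((card W)\<^sup>2) \<le> real ((2 * d * K)\<^sup>2)" by (rule of_nat_mono)
      then have "(real (card W))\<^sup>2 / real (h - 1) \<le> r"
        unfolding r_def by (intro divide_right_mono) simp_all
      with prob_uniform_perm_image_meets_le[OF W h]
      have r: "measure_pmf.prob ?U {\<rho>. W \<inter> \<rho> ` W \<noteq> {}} \<le> r" by simp
      show "measure_pmf.prob
         (do {\<rho> \<leftarrow> ?U; \<gamma> \<leftarrow> ?U; \<gamma>' \<leftarrow> ?U; return_pmf (P \<tau> \<pi> \<rho> \<gamma> \<gamma>')}) {False} \<le> r + (q + (q + 0))"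
      proof (rule prob_bind_pmf_le[OF r])
        fix \<rho> assume rho: "\<rho> \<in> set_pmf ?U" "\<rho> \<notin> {\<rho>. W \<inter> \<rho> ` W \<noteq> {}}"
        show "measure_pmf.prob (do {\<gamma> \<leftarrow> ?U; \<gamma>' \<leftarrow> ?U; return_pmf (P \<tau> \<pi> \<rho> \<gamma> \<gamma>')}) {False} \<le> q + (q + 0)"
        proof (rule prob_bind_pmf_le[OF q[OF pi, of "\<lambda>j. \<rho> (\<pi> j)"]])
          fix \<gamma> assume g: "\<gamma> \<in> set_pmf ?U"
            "\<gamma> \<notin> {\<gamma>. \<not> closure_until \<pi> V {j. s (\<gamma> j) \<noteq> s (\<rho> (\<pi> j))} \<subseteq> iterates d \<pi> V}"
          show "measure_pmf.prob (do {\<gamma>' \<leftarrow> ?U; return_pmf (P \<tau> \<pi> \<rho> \<gamma> \<gamma>')}) {False} \<le> q + 0"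
          proof (rule prob_bind_pmf_le[OF q[OF pi', of \<rho>]])
            fix \<gamma>' assume g': "\<gamma>' \<in> set_pmf ?U"
              "\<gamma>' \<notin> {\<gamma>. \<not> closure_until (inv \<pi>) V {j. s (\<gamma> j) \<noteq> s (\<rho> j)} \<subseteq> iterates d (inv \<pi>) V}"
            define S where "S = closure_until \<pi> V {j. s (\<gamma> j) \<noteq> s (\<rho> (\<pi> j))}
                \<union> closure_until (inv \<pi>) V {j. s (\<gamma>' j) \<noteq> s (\<rho> j)}"
            have "S \<subseteq> W" using g g' unfolding S_def W_def by blast
            then have "S \<inter> \<rho> ` S = {}" using rho by blast
            from ex_reindexed_colouring[OF pi in_perm[OF rho(1)] s S_def this]
            have "P \<tau> \<pi> \<rho> \<gamma> \<gamma>'"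
              using P tau_perm pi in_perm[OF rho(1)] in_perm[OF g(1)] in_perm[OF g'(1)] by blast
            then show "measure_pmf.prob (return_pmf (P \<tau> \<pi> \<rho> \<gamma> \<gamma>')) {False} \<le> 0" by simp
          qed simp
        qed (use nn in auto)
      qed (use nn in auto)
    qed (use nn in auto)
  qed (use nn in auto)
  then show ?thesis by (simp add: q_def r_def)
qed

text \<open>Multiplying by fixed permutations on both sides is a bijection of the symmetric group,
  so it preserves the uniform distribution.\<close>

lemma bind_uniform_perm_translate:
  assumes A: "finite A" and g: "g permutes A" and k: "k permutes A"
  shows "bind_pmf (uniform_perm A) f = bind_pmf (uniform_perm A) (\<lambda>p. f (g \<circ> p \<circ> k))"
proof -
  have "bij_betw (\<lambda>p. g \<circ> p \<circ> k) {p. p permutes A} {p. p permutes A}"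
  proof (rule bij_betw_byWitness[where f' = "\<lambda>p. inv g \<circ> p \<circ> inv k"])
    show "\<forall>p\<in>{p. p permutes A}. inv g \<circ> (g \<circ> p \<circ> k) \<circ> inv k = p"
      "\<forall>p\<in>{p. p permutes A}. g \<circ> (inv g \<circ> p \<circ> inv k) \<circ> k = p"
      by (auto simp: fun_eq_iff permutes_inverses[OF g] permutes_inverses[OF k])
  qed (use g k in \<open>auto intro!: permutes_compose permutes_inv\<close>)
  then have "map_pmf (\<lambda>p. g \<circ> p \<circ> k) (uniform_perm A) = uniform_perm A"
    by (rule map_pmf_of_set_bij_betw[OF _ permutations_nonempty finite_permutations[OF A]])
  then have "bind_pmf (uniform_perm A) f = bind_pmf (map_pmf (\<lambda>p. g \<circ> p \<circ> k) (uniform_perm A)) f"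
    by simp
  then show ?thesis by (simp add: bind_map_pmf)
qed

section \<open>Change of orientation\<close>

text \<open>Reversing an arc inverts its permutation. The value \<open>id\<close> outside
  \<open>D'\<close> agrees with the default of \<open>random_lift\<close>, so the map is a bijection
  between the supports.\<close>

definition reorient :: "('a \<times> 'a) set \<Rightarrow> ('a \<times> 'a) set \<Rightarrow> ('a \<times> 'a \<Rightarrow> 'b \<Rightarrow> 'b) \<Rightarrow> 'a \<times> 'a \<Rightarrow> 'b \<Rightarrow> 'b" where
  "reorient D D' \<sigma> e = (if e \<in> D' then if e \<in> D then \<sigma> e else inv (\<sigma> (prod.swap e)) else id)"

lemma orientation_memD:
  "orientation G D \<Longrightarrow> orientation G D' \<Longrightarrow> e \<in> D' \<Longrightarrow> e \<notin> D \<Longrightarrow> prod.swap e \<in> D \<and> prod.swap e \<notin> D'"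
  by (cases e) (fastforce simp: orientation_def)

lemma reorient_in:
  assumes "orientation G D" "orientation G D'" "\<sigma> \<in> PiE_dflt D id (\<lambda>_. {p. p permutes A})"
  shows "reorient D D' \<sigma> \<in> PiE_dflt D' id (\<lambda>_. {p. p permutes A})"
  using assms(3) orientation_memD[OF assms(1,2)]
  by (auto simp: PiE_dflt_def reorient_def intro!: permutes_inv simp del: swap_simp split_paired_All)

lemma reorient_reorient:
  assumes "orientation G D" "orientation G D'" "\<sigma> \<in> PiE_dflt D id (\<lambda>_. {p. p permutes A})"
  shows "reorient D' D (reorient D D' \<sigma>) = \<sigma>"
proof
  fix e
  have \<sigma>: "\<sigma> e permutes A" if "e \<in> D" for e using that assms(3) by (simp add: PiE_dflt_def del: split_paired_All)
  show "reorient D' D (reorient D D' \<sigma>) e = \<sigma> e"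
  proof (cases "e \<in> D")
    case False
    then show ?thesis using assms(3) by (simp add: PiE_dflt_def reorient_def del: split_paired_All)
  next
    case True
    then show ?thesis
      using orientation_memD[OF assms(2,1), of e] permutes_inv_inv[OF \<sigma>[OF True]]
      by (cases "e \<in> D'") (auto simp: reorient_def simp del: swap_simp)
  qed
qed

text \<open>One inclusion suffices: the other is the same statement with the orientations exchanged,
  as \<open>reorient\<close> undoes itself.\<close>

lemma lift_arcs_reorient_subset:
  assumes "orientation G D" "orientation G D'" "\<sigma> \<in> PiE_dflt D id (\<lambda>_. {p. p permutes {1..h}})"
  shows "lift_arcs D' h (reorient D D' \<sigma>) \<subseteq> lift_arcs D h \<sigma> \<union> (lift_arcs D h \<sigma>)\<inverse>"
proof
  fix x assume "x \<in> lift_arcs D' h (reorient D D' \<sigma>)"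
  then obtain u v j where x: "x = ((u, j), (v, reorient D D' \<sigma> (u, v) j))"
    and uv: "(u, v) \<in> D'" and j: "j \<in> {1..h}"
    by (auto simp: lift_arcs_def)
  show "x \<in> lift_arcs D h \<sigma> \<union> (lift_arcs D h \<sigma>)\<inverse>"
  proof (cases "(u, v) \<in> D")
    case True
    then show ?thesis using x uv j by (auto simp: lift_arcs_def reorient_def)
  next
    case False
    then have vu: "(v, u) \<in> D" using orientation_memD[OF assms(1,2) uv] by simp
    then have p: "\<sigma> (v, u) permutes {1..h}" using assms(3) by (simp add: PiE_dflt_def)
    define i where "i = inv (\<sigma> (v, u)) j"
    have "i \<in> {1..h}" unfolding i_def using permutes_in_image[OF permutes_inv[OF p]] j by blast
    moreover have "\<sigma> (v, u) i = j" unfolding i_def by (rule permutes_inverses(1)[OF p])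
    moreover have "x = ((u, j), (v, i))" using x uv False by (simp add: reorient_def i_def)
    ultimately show ?thesis using vu by (auto simp: lift_arcs_def)
  qed
qed

lemma lift_graph_reorient:
  assumes "orientation G D" "orientation G D'" "\<sigma> \<in> PiE_dflt D id (\<lambda>_. {p. p permutes {1..h}})"
  shows "lift_graph G D' h (reorient D D' \<sigma>) = lift_graph G D h \<sigma>"
  using lift_arcs_reorient_subset[OF assms]
    lift_arcs_reorient_subset[OF assms(2,1) reorient_in[OF assms]] reorient_reorient[OF assms]
  unfolding lift_graph_def by auto

text \<open>Both families are uniform on finite sets, and \<open>reorient\<close> is a bijection
  between these that leaves the lifted graph unchanged.\<close>

lemma random_lift_orientation_irrelevant:
  assumes fin: "finite (parcs G)" and D: "orientation G D" and D': "orientation G D'"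
  shows "random_lift G D h = random_lift G D' h"
proof -
  let ?P = "\<lambda>_. {p. p permutes {1..h}}"
  have finD: "finite D" "finite D'"
    using D D' fin by (auto simp: orientation_def intro: finite_subset)
  have bij: "bij_betw (reorient D D') (PiE_dflt D id ?P) (PiE_dflt D' id ?P)"
    by (rule bij_betw_byWitness[where f' = "reorient D' D"])
       (use reorient_in[OF D D'] reorient_in[OF D' D] reorient_reorient[OF D D'] reorient_reorient[OF D' D]
         in auto)
  have fin: "finite (PiE_dflt D id ?P)"
    by (intro finite_PiE_dflt finD) (simp add: finite_permutations)
  have ne: "PiE_dflt D id ?P \<noteq> {}"
    using permutes_id by (auto simp: PiE_dflt_def intro!: exI[of _ "\<lambda>_. id"])
  have Pi: "Pi_pmf D id (\<lambda>_. uniform_perm {1..h}) = pmf_of_set (PiE_dflt D id ?P)" if "finite D" for D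
    by (rule Pi_pmf_of_set[OF that finite_permutations permutations_nonempty]) simp
  have "random_lift G D' h = map_pmf (lift_graph G D' h) (map_pmf (reorient D D') (Pi_pmf D id (\<lambda>_. uniform_perm {1..h})))"
    unfolding random_lift_def Pi[OF finD(1)] Pi[OF finD(2)] map_pmf_of_set_bij_betw[OF bij ne fin] ..
  also have "\<dots> = random_lift G D h"
    unfolding random_lift_def pmf.map_comp
  proof (rule map_pmf_cong[OF refl])
    fix \<sigma> assume "\<sigma> \<in> set_pmf (Pi_pmf D id (\<lambda>_. uniform_perm {1..h}))"
    then have "\<sigma> \<in> PiE_dflt D id ?P" unfolding Pi[OF finD(1)] set_pmf_of_set[OF ne fin] .
    then show "(lift_graph G D' h \<circ> reorient D D') \<sigma> = lift_graph G D h \<sigma>"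
      using lift_graph_reorient[OF D D'] by simp
  qed
  finally show ?thesis ..
qed

section \<open>Random lifts\<close>

text \<open>The arcs with permutations \<open>p\<close>, \<open>q\<close>, \<open>r\<close>,
  \<open>t\<close> form a spanning tree. Renaming the fibres turns these four into identities, and
  the cotree equations express the other five matchings in the new indices.\<close>

lemma colourable_lift_graph_of_reindexed_colouring:
  assumes dist: "distinct [x, y, a, b, c]" and G: "pverts G = {x, y, a, b, c}"
    and D: "D = {(a, b), (b, c), (x, a), (y, a), (c, a), (x, b), (y, b), (x, c), (y, c)}"
    and perms: "p permutes {1..h}" "q permutes {1..h}" "r permutes {1..h}" "t permutes {1..h}"
      "\<pi> permutes {1..h}" "\<rho> permutes {1..h}" "\<gamma> permutes {1..h}" "\<gamma>' permutes {1..h}"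
    and tree: "\<sigma> (a, b) = p" "\<sigma> (b, c) = q" "\<sigma> (x, a) = r" "\<sigma> (y, a) = t"
    and cotree: "\<sigma> (c, a) = \<tau> \<circ> inv (q \<circ> p)" "\<sigma> (x, b) = p \<circ> \<rho> \<circ> \<pi> \<circ> r" "\<sigma> (y, b) = p \<circ> \<rho> \<circ> t"
      "\<sigma> (x, c) = q \<circ> p \<circ> \<gamma> \<circ> r" "\<sigma> (y, c) = q \<circ> p \<circ> \<gamma>' \<circ> t"
    and col: "reindexed_colouring h \<tau> \<pi> \<rho> \<gamma> \<gamma>' ca cb cc cx cy"
  shows "colourable 3 (lift_graph G D h \<sigma>)"
proof -
  note inv_simps = permutes_inverses[OF perms(1)] permutes_inverses[OF permutes_compose[OF perms(1,2)]]
  \<comment> \<open>The inverses translate an old index to the new one. For x and y no inverse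
    occurs, since their tree arcs point towards a; the last branch serves y.\<close>
  define f where "f = (\<lambda>(w, i). if w = a then ca i else if w = b then cb (inv p i)
     else if w = c then cc (inv (q \<circ> p) i) else if w = x then cx (r i) else cy (t i))"
  have f[simp]: "f (a, i) = ca i" "f (b, p i) = cb i" "f (c, q (p i)) = cc i"
      "f (x, i) = cx (r i)" "f (y, i) = cy (t i)" for i
    using dist inv_simps by (auto simp: f_def)
  have *: "\<exists>i\<in>{1..h}. j = p i" "\<exists>i\<in>{1..h}. j = q (p i)" if "j \<in> {1..h}" for j
    using that permutes_image[OF perms(1)] permutes_image[OF permutes_compose[OF perms(1,2)]]
    by (auto simp: image_iff set_eq_iff)
  have [simp]: "\<sigma> (c, a) (q (p i)) = \<tau> i" for i using inv_simps(4) by (simp add: cotree)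
  have in_h: "r i \<in> {1..h}" "t i \<in> {1..h}" if "i \<in> {1..h}" for i
    using that permutes_in_image[OF perms(3)] permutes_in_image[OF perms(4)] by blast+
  note col' = col[unfolded reindexed_colouring_def, THEN conjunct2, rule_format]
  have "f (w, j) \<noteq> f (z, \<sigma> (w, z) j)" if wz: "(w, z) \<in> D" and j: "j \<in> {1..h}" for w z j
  proof -
    obtain i i' where i: "i \<in> {1..h}" "j = p i" and i': "i' \<in> {1..h}" "j = q (p i')"
      using *[OF j] by blast
    note cols = col'[OF j] col'[OF i(1)] col'[OF i'(1)] col'[OF in_h(1)[OF j]] col'[OF in_h(2)[OF j]]
    from wz consider "w = a" "z = b" | "w = b" "z = c" | "w = x" "z = a" | "w = y" "z = a"
      | "w = c" "z = a" | "w = x" "z = b" | "w = y" "z = b" | "w = x" "z = c" | "w = y" "z = c"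
      unfolding D by blast
    then show ?thesis
    proof cases
      case 1 then show ?thesis using cols by (simp add: tree)
    next
      case 2 then show ?thesis using cols i(2) by (simp add: tree)
    next
      case 3 then show ?thesis using cols by (simp add: tree)
    next
      case 4 then show ?thesis using cols by (simp add: tree)
    next
      case 5 then show ?thesis using cols i'(2) by simp
    next
      case 6 then show ?thesis using cols by (simp add: cotree)
    next
      case 7 then show ?thesis using cols by (simp add: cotree)
    next
      case 8 then show ?thesis using cols by (simp add: cotree)
    next
      case 9 then show ?thesis using cols by (simp add: cotree)
    qed
  qed
  then have arcs: "f e \<noteq> f e'" if "(e, e') \<in> lift_arcs D h \<sigma>" for e e'
    using that by (auto simp: lift_arcs_def)
  have "f e < 3" for e
    using col by (cases e) (simp add: f_def reindexed_colouring_def)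
  then have "proper_colouring 3 (lift_graph G D h \<sigma>) f"
    using arcs by (fastforce simp: proper_colouring_def lift_graph_def)
  then show ?thesis unfolding colourable_def by blast
qed

text \<open>With the four tree permutations fixed, the five cotree permutations are translates of
  independent uniform ones, and the bound for the reindexed matchings applies.\<close>

lemma prob_not_colourable_le:
  fixes x y a b c :: 'a
  assumes dist: "distinct [x, y, a, b, c]" and G: "pverts G = {x, y, a, b, c}"
    and D: "D = {(a, b), (b, c), (x, a), (y, a), (c, a), (x, b), (y, b), (x, c), (y, c)}"
    and h: "1 < h" and d: "0 < d" "d < h" and K: "0 < K"
  shows "measure_pmf.prob (random_lift G D h) {L. \<not> colourable 3 L}
    \<le> harm h / real K + (real (2 * d * K))\<^sup>2 / real (h - 1) + 2 * real K * (real (h + K) / real (2 * (h - d))) ^ d"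
    (is "_ \<le> ?eps")
proof -
  let ?U = "uniform_perm {1..h}"
  have dist': "distinct [c, b, a, y, x]" using dist by auto
  define R where "R p q r t ca xb yb xc yc \<longleftrightarrow> colourable 3 (lift_graph G D h ((\<lambda>_. id)
      ((y, c) := yc, (x, c) := xc, (y, b) := yb, (x, b) := xb, (c, a) := ca,
       (y, a) := t, (x, a) := r, (b, c) := q, (a, b) := p)))" for p q r t ca xb yb xc yc
  have expand: "map_pmf (\<lambda>\<sigma>. colourable 3 (lift_graph G D h \<sigma>)) (Pi_pmf D id (\<lambda>_. ?U))
    = do {p \<leftarrow> ?U; q \<leftarrow> ?U; r \<leftarrow> ?U; t \<leftarrow> ?U; ca \<leftarrow> ?U; xb \<leftarrow> ?U; yb \<leftarrow> ?U; xc \<leftarrow> ?U; yc \<leftarrow> ?U;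
          return_pmf (R p q r t ca xb yb xc yc)}"
    unfolding R_def using dist dist'
    by (subst (2) D)
       (simp add: Pi_pmf_insert' map_bind_pmf bind_assoc_pmf bind_return_pmf del: atLeastAtMost_iff)
  have in_perm: "s permutes {1..h}" if "s \<in> set_pmf ?U" for s
    using that by (simp add: set_uniform_perm)
  define eps where "eps = ?eps"
  have eps: "0 \<le> eps" unfolding eps_def by (intro add_nonneg_nonneg divide_nonneg_nonneg) (auto simp: harm_nonneg)
  have tree: "measure_pmf.prob (do {ca \<leftarrow> ?U; xb \<leftarrow> ?U; yb \<leftarrow> ?U; xc \<leftarrow> ?U; yc \<leftarrow> ?U;
          return_pmf (R p q r t ca xb yb xc yc)}) {False} \<le> eps"
    if perms: "p permutes {1..h}" "q permutes {1..h}" "r permutes {1..h}" "t permutes {1..h}" for p q r t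
  proof -
    note pq = permutes_compose[OF perms(1,2)]
    note tr = bind_uniform_perm_translate[OF finite_atLeastAtMost]
    \<comment> \<open>\<open>yb\<close> is moved ahead of \<open>xb\<close> because the substitution
      for \<open>xb\<close> involves \<open>\<rho>\<close>, which comes from
      \<open>yb\<close>.\<close>
    have "(do {ca \<leftarrow> ?U; xb \<leftarrow> ?U; yb \<leftarrow> ?U; xc \<leftarrow> ?U; yc \<leftarrow> ?U; return_pmf (R p q r t ca xb yb xc yc)})
      = (do {ca \<leftarrow> ?U; yb \<leftarrow> ?U; xb \<leftarrow> ?U; xc \<leftarrow> ?U; yc \<leftarrow> ?U; return_pmf (R p q r t ca xb yb xc yc)})"
      by (intro bind_pmf_cong refl bind_commute_pmf)
    also have "\<dots> = (do {\<tau> \<leftarrow> ?U; yb \<leftarrow> ?U; xb \<leftarrow> ?U; xc \<leftarrow> ?U; yc \<leftarrow> ?U;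
        return_pmf (R p q r t (\<tau> \<circ> inv (q \<circ> p)) xb yb xc yc)})"
      by (subst tr[OF permutes_id permutes_inv[OF pq]]) simp
    also have "\<dots> = (do {\<tau> \<leftarrow> ?U; \<rho> \<leftarrow> ?U; xb \<leftarrow> ?U; xc \<leftarrow> ?U; yc \<leftarrow> ?U;
        return_pmf (R p q r t (\<tau> \<circ> inv (q \<circ> p)) xb (p \<circ> \<rho> \<circ> t) xc yc)})"
      by (rule bind_pmf_cong[OF refl], rule tr[OF perms(1,4)])
    also have "\<dots> = (do {\<tau> \<leftarrow> ?U; \<rho> \<leftarrow> ?U; \<pi> \<leftarrow> ?U; xc \<leftarrow> ?U; yc \<leftarrow> ?U;
        return_pmf (R p q r t (\<tau> \<circ> inv (q \<circ> p)) (p \<circ> \<rho> \<circ> \<pi> \<circ> r) (p \<circ> \<rho> \<circ> t) xc yc)})"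
      by (rule bind_pmf_cong[OF refl], rule bind_pmf_cong[OF refl],
          rule tr[OF permutes_compose[OF in_perm perms(1)] perms(3)])
    also have "\<dots> = (do {\<tau> \<leftarrow> ?U; \<rho> \<leftarrow> ?U; \<pi> \<leftarrow> ?U; \<gamma> \<leftarrow> ?U; yc \<leftarrow> ?U;
        return_pmf (R p q r t (\<tau> \<circ> inv (q \<circ> p)) (p \<circ> \<rho> \<circ> \<pi> \<circ> r) (p \<circ> \<rho> \<circ> t) (q \<circ> p \<circ> \<gamma> \<circ> r) yc)})"
      by (rule bind_pmf_cong[OF refl], rule bind_pmf_cong[OF refl], rule bind_pmf_cong[OF refl],
          rule tr[OF pq perms(3)])
    also have "\<dots> = (do {\<tau> \<leftarrow> ?U; \<rho> \<leftarrow> ?U; \<pi> \<leftarrow> ?U; \<gamma> \<leftarrow> ?U; \<gamma>' \<leftarrow> ?U;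
        return_pmf (R p q r t (\<tau> \<circ> inv (q \<circ> p)) (p \<circ> \<rho> \<circ> \<pi> \<circ> r) (p \<circ> \<rho> \<circ> t) (q \<circ> p \<circ> \<gamma> \<circ> r) (q \<circ> p \<circ> \<gamma>' \<circ> t))})"
      by (rule bind_pmf_cong[OF refl], rule bind_pmf_cong[OF refl], rule bind_pmf_cong[OF refl],
          rule bind_pmf_cong[OF refl], rule tr[OF pq perms(4)])
    \<comment> \<open>Back to drawing \<open>\<pi>\<close> before \<open>\<rho>\<close>, the order
      in which the walks are analysed.\<close>
    also have "\<dots> = (do {\<tau> \<leftarrow> ?U; \<pi> \<leftarrow> ?U; \<rho> \<leftarrow> ?U; \<gamma> \<leftarrow> ?U; \<gamma>' \<leftarrow> ?U;
        return_pmf (R p q r t (\<tau> \<circ> inv (q \<circ> p)) (p \<circ> \<rho> \<circ> \<pi> \<circ> r) (p \<circ> \<rho> \<circ> t) (q \<circ> p \<circ> \<gamma> \<circ> r) (q \<circ> p \<circ> \<gamma>' \<circ> t))})"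
      by (rule bind_pmf_cong[OF refl], rule bind_commute_pmf)
    finally have eq: "(do {ca \<leftarrow> ?U; xb \<leftarrow> ?U; yb \<leftarrow> ?U; xc \<leftarrow> ?U; yc \<leftarrow> ?U; return_pmf (R p q r t ca xb yb xc yc)}) = \<dots>" .
    show ?thesis unfolding eq eps_def
    proof (rule prob_no_reindexed_colouring_le[OF h d K])
      fix \<tau> \<pi> \<rho> \<gamma> \<gamma>' ca cb cc cx cy
      assume "\<tau> permutes {1..h}" "\<pi> permutes {1..h}" "\<rho> permutes {1..h}" "\<gamma> permutes {1..h}"
        "\<gamma>' permutes {1..h}" "reindexed_colouring h \<tau> \<pi> \<rho> \<gamma> \<gamma>' ca cb cc cx cy"
      then show "R p q r t (\<tau> \<circ> inv (q \<circ> p)) (p \<circ> \<rho> \<circ> \<pi> \<circ> r) (p \<circ> \<rho> \<circ> t) (q \<circ> p \<circ> \<gamma> \<circ> r) (q \<circ> p \<circ> \<gamma>' \<circ> t)"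
        unfolding R_def
        by (intro colourable_lift_graph_of_reindexed_colouring[OF dist G D perms, of \<pi> \<rho> \<gamma> \<gamma>' _ \<tau> ca cb cc cx cy])
           (use dist dist' in auto)
    qed
  qed
  have "measure_pmf.prob (random_lift G D h) {L. \<not> colourable 3 L}
      = measure_pmf.prob (map_pmf (\<lambda>\<sigma>. colourable 3 (lift_graph G D h \<sigma>)) (Pi_pmf D id (\<lambda>_. ?U))) {False}"
    unfolding random_lift_def measure_map_pmf by (rule arg_cong[of _ _ "measure_pmf.prob _"]) auto
  also have "\<dots> \<le> 0 + (0 + (0 + (0 + eps)))"
    unfolding expand
  proof (rule prob_bind_pmf_le[of _ "{}"])
    fix p assume p: "p \<in> set_pmf ?U"
    show "measure_pmf.prob (do {q \<leftarrow> ?U; r \<leftarrow> ?U; t \<leftarrow> ?U; ca \<leftarrow> ?U; xb \<leftarrow> ?U; yb \<leftarrow> ?U; xc \<leftarrow> ?U; yc \<leftarrow> ?U;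
          return_pmf (R p q r t ca xb yb xc yc)}) {False} \<le> 0 + (0 + (0 + eps))"
    proof (rule prob_bind_pmf_le[of _ "{}"])
      fix q assume q: "q \<in> set_pmf ?U"
      show "measure_pmf.prob (do {r \<leftarrow> ?U; t \<leftarrow> ?U; ca \<leftarrow> ?U; xb \<leftarrow> ?U; yb \<leftarrow> ?U; xc \<leftarrow> ?U; yc \<leftarrow> ?U;
          return_pmf (R p q r t ca xb yb xc yc)}) {False} \<le> 0 + (0 + eps)"
      proof (rule prob_bind_pmf_le[of _ "{}"])
        fix r assume r: "r \<in> set_pmf ?U"
        show "measure_pmf.prob (do {t \<leftarrow> ?U; ca \<leftarrow> ?U; xb \<leftarrow> ?U; yb \<leftarrow> ?U; xc \<leftarrow> ?U; yc \<leftarrow> ?U;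
          return_pmf (R p q r t ca xb yb xc yc)}) {False} \<le> 0 + eps"
        proof (rule prob_bind_pmf_le[of _ "{}"])
          fix t assume t: "t \<in> set_pmf ?U"
          show "measure_pmf.prob (do {ca \<leftarrow> ?U; xb \<leftarrow> ?U; yb \<leftarrow> ?U; xc \<leftarrow> ?U; yc \<leftarrow> ?U;
          return_pmf (R p q r t ca xb yb xc yc)}) {False} \<le> eps"
            by (rule tree[OF in_perm[OF p] in_perm[OF q] in_perm[OF r] in_perm[OF t]])
        qed (use eps in simp_all)
      qed (use eps in simp_all)
    qed (use eps in simp_all)
  qed (use eps in simp_all)
  finally show ?thesis by (simp add: eps_def)
qed

section \<open>Asymptotics of the error bound\<close>

lemma harm_le_1_plus_ln: "n > 0 \<Longrightarrow> harm n \<le> 1 + ln (real n)"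
proof -
  assume "n > 0"
  then obtain m where n: "n = Suc m" by (cases n) auto
  have "harm (Suc m) - ln (real (Suc m)) \<le> harm (Suc 0) - ln (real (Suc 0))"
    using decseqD[OF decseq_harm_diff_ln, of 0 m] by simp
  then show ?thesis unfolding n by (simp add: harm_expand)
qed

text \<open>The same \<open>k h\<close> bounds the number of cycles and the length of the walks. It
  must outgrow \<open>ln h\<close> for the first term, while its fourth power must be of smaller
  order than \<open>h\<close> for the second; the exponent 1/8 meets both demands. The third term
  decays exponentially in \<open>k h\<close>.\<close>

lemma error_bound_tendsto_0:
  defines "k \<equiv> \<lambda>h::nat. nat \<lfloor>real h powr (1/8)\<rfloor>"
  shows "\<forall>\<^sub>F h in sequentially. 1 < h \<and> 0 < k h \<and> k h < h"
    and "(\<lambda>h. harm h / real (k h) + (real (2 * k h * k h))\<^sup>2 / real (h - 1)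
           + 2 * real (k h) * (real (h + k h) / real (2 * (h - k h))) ^ k h) \<longlonglongrightarrow> 0"
proof -
  have le: "real (k h) \<le> real h powr (1/8)" for h by (simp add: k_def)
  have ge: "real h powr (1/8) - 1 \<le> real (k h)" for h unfolding k_def by linarith
  have lim: "filterlim k at_top sequentially"
  proof -
    have "filterlim (\<lambda>h. real h powr (1/8) - 1) at_top sequentially" by real_asymp
    then have "filterlim (\<lambda>h. real (k h)) at_top sequentially"
      by (rule filterlim_at_top_mono) (use ge in simp)
    then show ?thesis by (simp add: filterlim_sequentially_iff_filterlim_real)
  qed
  \<comment> \<open>The factor 7 is exactly what makes the base of the power at most 2/3.\<close>
  have large: "\<forall>\<^sub>F h in sequentially. 1 < h \<and> 0 < k h \<and> 7 * k h \<le> h"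
  proof -
    have "\<forall>\<^sub>F h in sequentially. 7 * (real h powr (1/8)) \<le> real h" by real_asymp
    moreover have "\<forall>\<^sub>F h in sequentially. 1 < k h" 
      using eventually_compose_filterlim[OF eventually_gt_at_top lim] .
    moreover have "\<forall>\<^sub>F h in sequentially. (1::nat) < h" by (rule eventually_gt_at_top)
    ultimately show ?thesis
    proof eventually_elim
      case (elim h)
      then have "real (7 * k h) \<le> real h" using le[of h] by simp
      then show ?case using elim by linarith
    qed
  qed
  then show "\<forall>\<^sub>F h in sequentially. 1 < h \<and> 0 < k h \<and> k h < h"
    by eventually_elim auto
  have 1: "(\<lambda>h. (1 + ln (real h)) / (real h powr (1/8) - 1)) \<longlonglongrightarrow> 0" by real_asymp
  have 2: "(\<lambda>h. (2 * (real h powr (1/8) * real h powr (1/8)))\<^sup>2 / (real h - 1)) \<longlonglongrightarrow> 0" by real_asymp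
  have "(\<lambda>n::nat. 2 * real n * (2/3) ^ n) \<longlonglongrightarrow> 0" by real_asymp
  then have 3: "(\<lambda>h. 2 * real (k h) * (2/3) ^ k h) \<longlonglongrightarrow> 0"
    by (rule filterlim_compose[OF _ lim])
  have lim_sum: "(\<lambda>h. (1 + ln (real h)) / (real h powr (1/8) - 1)
      + (2 * (real h powr (1/8) * real h powr (1/8)))\<^sup>2 / (real h - 1) + 2 * real (k h) * (2/3) ^ k h) \<longlonglongrightarrow> 0"
    using tendsto_add[OF tendsto_add[OF 1 2] 3] by simp
  \<comment> \<open>This keeps the denominator \<open>real h powr (1/8) - 1\<close>
    positive.\<close>
  have big: "\<forall>\<^sub>F h in sequentially. 1 < real h powr (1/8)" by real_asymp
  show "(\<lambda>h. harm h / real (k h) + (real (2 * k h * k h))\<^sup>2 / real (h - 1)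
           + 2 * real (k h) * (real (h + k h) / real (2 * (h - k h))) ^ k h) \<longlonglongrightarrow> 0"
  proof (rule tendsto_sandwich[OF _ _ tendsto_const lim_sum])
    show "\<forall>\<^sub>F h in sequentially. 0 \<le> harm h / real (k h) + (real (2 * k h * k h))\<^sup>2 / real (h - 1)
           + 2 * real (k h) * (real (h + k h) / real (2 * (h - k h))) ^ k h"
      by (intro always_eventually allI add_nonneg_nonneg divide_nonneg_nonneg) (auto simp: harm_nonneg)
    show "\<forall>\<^sub>F h in sequentially. harm h / real (k h) + (real (2 * k h * k h))\<^sup>2 / real (h - 1)
           + 2 * real (k h) * (real (h + k h) / real (2 * (h - k h))) ^ k h
        \<le> (1 + ln (real h)) / (real h powr (1/8) - 1)
      + (2 * (real h powr (1/8) * real h powr (1/8)))\<^sup>2 / (real h - 1) + 2 * real (k h) * (2/3) ^ k h"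
      using large big
    proof eventually_elim
      case (elim h)
      show ?case
      proof (intro add_mono mult_left_mono power_mono)
        show "harm h / real (k h) \<le> (1 + ln (real h)) / (real h powr (1/8) - 1)"
          using elim ge[of h] by (intro frac_le harm_le_1_plus_ln) (auto simp: harm_nonneg)
        show "(real (2 * k h * k h))\<^sup>2 / real (h - 1)
            \<le> (2 * (real h powr (1/8) * real h powr (1/8)))\<^sup>2 / (real h - 1)"
        proof (rule frac_le)
          have "real (2 * k h * k h) \<le> 2 * (real h powr (1/8) * real h powr (1/8))"
            using mult_mono[OF le[of h] le[of h]] by simp
          then show "(real (2 * k h * k h))\<^sup>2 \<le> (2 * (real h powr (1/8) * real h powr (1/8)))\<^sup>2"
            by (rule power_mono) simp
        qed (use elim in auto)
        show "real (h + k h) / real (2 * (h - k h)) \<le> 2 / 3"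
          using elim by (simp add: divide_simps)
      qed auto
    qed
  qed
qed

theorem theorem1:
  fixes K :: "'a pair_pre_digraph" and u v :: 'a and D :: "('a \<times> 'a) set"
  assumes "complete_digraph 5 (with_proj K)"
    and "(u, v) \<in> parcs K"
    and "orientation (delete_edge K u v) D"
  shows "(\<lambda>h. measure_pmf.prob (random_lift (delete_edge K u v) D h) {L. colourable 3 L})
           \<longlonglongrightarrow> 1"
proof -
  let ?G = "delete_edge K u v"
  have fin: "finite (pverts K)" and card: "card (pverts K) = 5"
    and arcs: "parcs K = {(u, v). (u, v) \<in> pverts K \<times> pverts K \<and> u \<noteq> v}"
    using assms(1) unfolding complete_digraph_pair_def by auto
  have uv: "u \<in> pverts K" "v \<in> pverts K" "u \<noteq> v" using assms(2) unfolding arcs by auto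
  have "card (pverts K - {u, v}) = 3" using fin card uv by (simp add: card_Diff_subset)
  then obtain a b c where abc: "pverts K - {u, v} = {a, b, c}" "a \<noteq> b" "a \<noteq> c" "b \<noteq> c"
    unfolding card_3_iff by auto
  then have ne: "a \<notin> {u, v}" "b \<notin> {u, v}" "c \<notin> {u, v}" by auto
  have dist: "distinct [u, v, a, b, c]" using abc ne uv by auto
  have dist': "distinct [c, b, a, v, u]" using dist by auto
  have V: "pverts K = {u, v, a, b, c}" using abc(1) uv by auto
  \<comment> \<open>The ends \<open>u\<close>, \<open>v\<close> of the deleted edge play the parts
    of x and y; the first four arcs are the spanning tree.\<close>
  define D' where "D' = {(a, b), (b, c), (u, a), (v, a), (c, a), (u, b), (v, b), (u, c), (v, c)}"
  have D': "orientation ?G D'"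
  proof -
    have conv: "D'\<inverse> = {(b, a), (c, b), (a, u), (a, v), (a, c), (b, u), (b, v), (c, u), (c, v)}"
      unfolding D'_def by blast
    have "D' \<inter> D'\<inverse> = {}" unfolding conv unfolding D'_def using dist dist' by simp
    moreover have "D' \<union> D'\<inverse> \<subseteq> parcs ?G"
      unfolding conv unfolding D'_def delete_edge_def arcs V using dist dist' by simp
    moreover have "parcs ?G \<subseteq> D' \<union> D'\<inverse>"
      unfolding conv unfolding D'_def delete_edge_def arcs V by auto
    ultimately show ?thesis unfolding orientation_def by blast
  qed
  have "finite (parcs ?G)"
    by (rule finite_subset[of _ "pverts K \<times> pverts K"]) (use fin in \<open>auto simp: delete_edge_def arcs\<close>)
  then have eq: "random_lift ?G D h = random_lift ?G D' h" for h
    by (rule random_lift_orientation_irrelevant[OF _ assms(3) D'])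
  have VG: "pverts ?G = {u, v, a, b, c}" by (simp add: delete_edge_def V)
  define k where "k h = nat \<lfloor>real h powr (1/8)\<rfloor>" for h :: nat
  note err = error_bound_tendsto_0[folded k_def]
  let ?bad = "\<lambda>h. measure_pmf.prob (random_lift ?G D h) {L. \<not> colourable 3 L}"
  have "?bad \<longlonglongrightarrow> 0"
  proof (rule tendsto_sandwich[OF _ _ tendsto_const err(2)])
    show "\<forall>\<^sub>F h in sequentially. ?bad h \<le> harm h / real (k h) + (real (2 * k h * k h))\<^sup>2 / real (h - 1)
           + 2 * real (k h) * (real (h + k h) / real (2 * (h - k h))) ^ k h"
      using err(1)
    proof eventually_elim
      case (elim h)
      have "1 < h" "0 < k h" "k h < h" using elim by auto
      then show ?case unfolding eq by (rule prob_not_colourable_le[OF dist VG D'_def _ _ _ \<open>0 < k h\<close>])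
    qed
  qed simp
  then have "(\<lambda>h. 1 - ?bad h) \<longlonglongrightarrow> 1 - 0" by (intro tendsto_diff tendsto_const)
  moreover have "1 - ?bad h = measure_pmf.prob (random_lift ?G D h) {L. colourable 3 L}" for h
    using measure_pmf.prob_compl[of "{L. \<not> colourable 3 L}" "random_lift ?G D h"]
    by (simp add: Compl_eq_Diff_UNIV[symmetric] Collect_neg_eq[symmetric])
  ultimately show ?thesis by simp
qed

end
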